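(* Let $\gamma$ and $\delta$ be principal continuous TRs of topological spaces $X$ and $Y$, respectively. Then a function $f:X\to Y$ is sequentially continuous iff there exists a continuous $\hat f:\mathcal{N}\to\mathcal{N}$ with $f\circ\gamma=\delta\circ\hat f$. In particular, for $A,B\subseteq X$, $A\leq_W B$ (in $X$) implies $\gamma^{-1}(A)\leq_W\gamma^{-1}(B)$ (in $\mathcal{N}$).
   Context: $\mathcal{N}=\omega^\omega$ is the Baire space. A principal continuous TR of a space $X$ is a continuous surjection $\gamma:\mathcal{N}\to X$ such that every continuous $\nu:\mathcal{N}\to X$ satisfies $\nu=\gamma\circ g$ for some continuous $g:\mathcal{N}\to\mathcal{N}$. A sequence $\{x_n\}$ converges to $x$ in a space if every open set containing $x$ contains $x_n$ for all sufficiently large $n$; $f:X\to Y$ is sequentially continuous if it maps convergent sequences to sequences converging to the image of the limit. For subsets $A,B$ of a space $Z$, $A\leq_W B$ (Wadge reducibility) iff $A=h^{-1}(B)$ for some continuous $h:Z\to Z$. *)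

theory Defs
  imports "HOL-Analysis.Analysis"
begin

text \<open>Spaces are abstract topologies, so a space may have any set as its carrier.\<close>

text \<open>Here \<^typ>\<open>nat\<close> carries the discrete topology and the function type
  the product topology.\<close>

abbreviation baire_space :: "(nat \<Rightarrow> nat) topology" where
  "baire_space \<equiv> euclidean"

lemma baire_space_eq_product_discrete:
  "baire_space = product_topology (\<lambda>_. discrete_topology UNIV) UNIV"
proof -
  have "(euclidean :: nat topology) = discrete_topology UNIV"
    by (simp add: topology_eq open_discrete)
  then show ?thesis
    by (simp add: euclidean_product_topology[symmetric])
qed

definition principal_continuous_TR :: "'a topology \<Rightarrow> ((nat \<Rightarrow> nat) \<Rightarrow> 'a) \<Rightarrow> bool" where
  "principal_continuous_TR X \<gamma> \<longleftrightarrow>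
     continuous_map baire_space X \<gamma> \<and> range \<gamma> = topspace X \<and>
     (\<forall>\<nu>. continuous_map baire_space X \<nu> \<longrightarrow>
        (\<exists>g. continuous_map baire_space baire_space g \<and> \<nu> = \<gamma> \<circ> g))"

text \<open>The range condition is needed because \<^const>\<open>limitin\<close> only constrains the
  sequence eventually.\<close>

definition sequentially_continuous_map :: "'a topology \<Rightarrow> 'b topology \<Rightarrow> ('a \<Rightarrow> 'b) \<Rightarrow> bool" where
  "sequentially_continuous_map X Y f \<longleftrightarrow>
     f \<in> topspace X \<rightarrow> topspace Y \<and>
     (\<forall>s x. range s \<subseteq> topspace X \<and> limitin X s x sequentially \<longrightarrow>
        limitin Y (f \<circ> s) (f x) sequentially)"

definition wadge_reducible :: "'a topology \<Rightarrow> 'a set \<Rightarrow> 'a set \<Rightarrow> bool" where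
  "wadge_reducible Z A B \<longleftrightarrow>
     (\<exists>h. continuous_map Z Z h \<and> A = {z \<in> topspace Z. h z \<in> B})"

end

(* Baire space is first countable, so a sequentially continuous map on it is continuous and
   can be lifted along a principal continuous TR.  Conversely, a sequence together with
   its limit is the image of a convergent sequence under a continuous map on Baire space,
   and principality lifts that sequence to one converging in the domain of \<gamma>. *)
theory Submission
  imports Defs
begin

lemma sequentially_continuous_mapD:
  assumes "sequentially_continuous_map X Y f" "range s \<subseteq> topspace X" "limitin X s x sequentially"
  shows "limitin Y (f \<circ> s) (f x) sequentially"
  using assms by (auto simp: sequentially_continuous_map_def)

lemma continuous_map_imp_sequentially_continuous_map:
  assumes "continuous_map X Y f"
  shows "sequentially_continuous_map X Y f"
  using assms continuous_map_limit[OF assms]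
  by (auto simp: sequentially_continuous_map_def continuous_map_def)

lemma sequentially_continuous_map_compose:
  assumes f: "sequentially_continuous_map X Y f" and g: "sequentially_continuous_map Y Z g"
  shows "sequentially_continuous_map X Z (g \<circ> f)"
  unfolding sequentially_continuous_map_def
proof (intro conjI allI impI)
  show "g \<circ> f \<in> topspace X \<rightarrow> topspace Z"
    using f g by (auto simp: sequentially_continuous_map_def)
  fix s x assume s: "range s \<subseteq> topspace X \<and> limitin X s x sequentially"
  then have "range (f \<circ> s) \<subseteq> topspace Y"
    using f by (auto simp: sequentially_continuous_map_def)
  with s show "limitin Z (g \<circ> f \<circ> s) ((g \<circ> f) x) sequentially"
    using sequentially_continuous_mapD[OF f] sequentially_continuous_mapD[OF g]
    by (metis comp_assoc comp_apply)
qed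

text \<open>In a first countable space a set is closed as soon as it contains the limits of its
  convergent sequences. The preimage of a closed set under \<open>\<phi>\<close> has this property,
  because \<open>\<phi>\<close> carries convergent sequences to convergent ones.\<close>

lemma sequentially_continuous_map_imp_continuous_map:
  fixes \<phi> :: "'a::first_countable_topology \<Rightarrow> 'b"
  assumes \<phi>: "sequentially_continuous_map euclidean Y \<phi>"
  shows "continuous_map euclidean Y \<phi>"
  unfolding continuous_map_closedin
proof (intro conjI allI impI)
  show "\<phi> \<in> topspace euclidean \<rightarrow> topspace Y"
    using \<phi> by (simp add: sequentially_continuous_map_def)
  fix C assume C: "closedin Y C"
  have "closed {p. \<phi> p \<in> C}"
    unfolding closed_sequential_limits
  proof (intro allI impI)
    fix s l assume s: "(\<forall>n. s n \<in> {p. \<phi> p \<in> C}) \<and> s \<longlonglongrightarrow> l"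
    then have "limitin Y (\<phi> \<circ> s) (\<phi> l) sequentially"
      using sequentially_continuous_mapD[OF \<phi>, of s l] by simp
    then have "\<phi> l \<in> C"
      by (rule limitin_closedin[OF _ C]) (use s in auto)
    then show "l \<in> {p. \<phi> p \<in> C}" by simp
  qed
  then show "closedin euclidean {p \<in> topspace euclidean. \<phi> p \<in> C}" by simp
qed

text \<open>A finite intersection of coordinate preimages of points, which are open in the discrete
  \<open>nat\<close>. These cylinders serve below as neighbourhoods for checking continuity by
  hand.\<close>

lemma open_baire_cylinder:
  fixes p :: "nat \<Rightarrow> nat"
  shows "open {q. \<forall>i<n. q i = p i}"
proof -
  have "open ((\<lambda>q. q i) -` {p i})" for i
    by (intro open_vimage open_discrete continuous_on_product_coordinates)
  then have "open (\<Inter>i<n. (\<lambda>q. q i) -` {p i})"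
    by (intro open_INT) auto
  also have "(\<Inter>i<n. (\<lambda>q. q i) -` {p i}) = {q. \<forall>i<n. q i = p i}" by auto
  finally show ?thesis .
qed

text \<open>The convergent sequence is encoded by the position of the first nonzero entry, the
  zero sequence representing the limit.\<close>

lemma convergent_sequence_as_baire_image:
  assumes s: "range s \<subseteq> topspace X" and lim: "limitin X s x sequentially"
  obtains \<nu> p l where "continuous_map baire_space X \<nu>" "p \<longlonglongrightarrow> l"
    "\<nu> \<circ> p = s" "\<nu> l = x"
proof -
  define l :: "nat \<Rightarrow> nat" where "l = (\<lambda>_. 0)"
  \<comment> \<open>The first nonzero entry of \<open>p n\<close> sits at \<open>n\<close>, so
    \<open>p n\<close> encodes the index \<open>n\<close>.\<close>
  define p :: "nat \<Rightarrow> nat \<Rightarrow> nat" where "p n = (\<lambda>i. if i = n then 1 else 0)" for n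
  define \<nu> where "\<nu> q = (if q = l then x else s (LEAST n. q n \<noteq> 0))" for q :: "nat \<Rightarrow> nat"
  have \<nu>l: "\<nu> l = x" by (simp add: \<nu>_def)
  have least: "\<nu> q = s n" if "q n \<noteq> 0" "\<forall>i<n. q i = 0" for q n
  proof -
    have "(LEAST n. q n \<noteq> 0) = n"
      using that by (intro Least_equality) (auto intro: leI)
    moreover have "q \<noteq> l" using that by (auto simp: l_def)
    ultimately show ?thesis by (simp add: \<nu>_def)
  qed
  have first: "\<exists>n. q n \<noteq> 0 \<and> (\<forall>i<n. q i = 0)" if "q \<noteq> l" for q
    using that exists_least_iff[of "\<lambda>n. q n \<noteq> 0"] by (auto simp: l_def)
  have \<nu>p: "\<nu> \<circ> p = s"
    using least by (auto simp: p_def)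
  have "(\<lambda>n. p n i) \<longlonglongrightarrow> l i" for i
    \<comment> \<open>Coordinate \<open>i\<close> of \<open>p n\<close> is nonzero only for
      \<open>n = i\<close>, hence constantly 0 from \<open>Suc i\<close> on.\<close>
    by (rule tendsto_eventually, rule eventually_sequentiallyI[of "Suc i"])
      (auto simp: p_def l_def)
  then have "limitin (product_topology (\<lambda>_. euclidean) UNIV) p l sequentially"
    by (simp add: limitin_componentwise)
  then have pl: "p \<longlonglongrightarrow> l"
    by (simp add: euclidean_product_topology)
  have "continuous_map baire_space X \<nu>"
    unfolding continuous_map_def
  proof (intro conjI allI impI)
    show "\<nu> \<in> topspace baire_space \<rightarrow> topspace X"
      using s limitin_topspace[OF lim] by (auto simp: \<nu>_def range_subsetD)
    fix U assume U: "openin X U"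
    have "open {q. \<nu> q \<in> U}"
    proof (subst open_subopen, intro ballI)
      fix q assume q: "q \<in> {q. \<nu> q \<in> U}"
      \<comment> \<open>It suffices to find a cylinder around \<open>q\<close> inside the preimage.
        At \<open>l\<close> its length comes from the convergence of \<open>s\<close>; elsewhere
        \<open>\<nu>\<close> is locally constant.\<close>
      have "\<exists>n. {r. \<forall>i<n. r i = q i} \<subseteq> {q. \<nu> q \<in> U}"
      proof (cases "q = l")
        case True
        then have "x \<in> U" using q by (simp add: \<nu>_def)
        then obtain N where N: "\<And>n. n \<ge> N \<Longrightarrow> s n \<in> U"
          using lim U by (auto simp: limitin_sequentially)
        \<comment> \<open>Such an \<open>r\<close> either is \<open>l\<close>, with value
          \<open>x\<close>, or has its first nonzero entry at some \<open>n \<ge> N\<close>, with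
          value \<open>s n\<close>; both lie in \<open>U\<close>.\<close>
        have "\<nu> r \<in> U" if r: "\<forall>i<N. r i = 0" for r
        proof (cases "r = l")
          case False
          then obtain n where n: "r n \<noteq> 0" "\<forall>i<n. r i = 0" using first by blast
          with r have "n \<ge> N" by (meson not_le)
          with n N least show ?thesis by simp
        qed (use \<open>x \<in> U\<close> in \<open>simp add: \<nu>_def\<close>)
        with True show ?thesis by (auto simp: l_def)
      next
        case False
        then obtain n where "q n \<noteq> 0" "\<forall>i<n. q i = 0" using first by blast
        \<comment> \<open>The bound is \<open>Suc n\<close> so that agreement includes the nonzero
          entry at \<open>n\<close> itself; then \<open>r\<close> and \<open>q\<close> encode the
          same index.\<close>
        then have "\<nu> r = \<nu> q" if "\<forall>i<Suc n. r i = q i" for r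
          using that least[of q n] least[of r n] by simp
        with q have "{r. \<forall>i<Suc n. r i = q i} \<subseteq> {q. \<nu> q \<in> U}"
          by (metis (mono_tags, lifting) mem_Collect_eq subsetI)
        then show ?thesis ..
      qed
      then show "\<exists>T. open T \<and> q \<in> T \<and> T \<subseteq> {q. \<nu> q \<in> U}"
        using open_baire_cylinder[of _ q] by blast
    qed
    then show "openin baire_space {q \<in> topspace baire_space. \<nu> q \<in> U}" by simp
  qed
  from that[OF this pl \<nu>p \<nu>l] show thesis .
qed

text \<open>Encode the sequence and its limit by a continuous \<open>\<nu>\<close> on Baire space
  and factor \<open>\<nu> = \<gamma> \<circ> g\<close>. The continuous \<open>g\<close> sends the
  convergent codes to convergent preimages under \<open>\<gamma>\<close>.\<close>

lemma principal_continuous_TR_limitin_lift: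
  assumes \<gamma>: "principal_continuous_TR X \<gamma>"
    and s: "range s \<subseteq> topspace X" and lim: "limitin X s x sequentially"
  obtains p l where "p \<longlonglongrightarrow> l" "\<gamma> \<circ> p = s" "\<gamma> l = x"
proof -
  obtain \<nu> p l where \<nu>: "continuous_map baire_space X \<nu>" and pl: "p \<longlonglongrightarrow> l"
    and eq: "\<nu> \<circ> p = s" "\<nu> l = x"
    using convergent_sequence_as_baire_image[OF s lim] by blast
  obtain g where g: "continuous_map baire_space baire_space g" "\<nu> = \<gamma> \<circ> g"
    using \<gamma> \<nu> unfolding principal_continuous_TR_def by blast
  have "(g \<circ> p) \<longlonglongrightarrow> g l"
    using continuous_map_limit[OF g(1), of p l] pl by simp
  then show ?thesis
    by (rule that) (use eq g in \<open>auto simp: o_assoc\<close>)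
qed

lemma sequentially_continuous_map_iff_lift:
  assumes \<gamma>: "principal_continuous_TR X \<gamma>" and \<delta>: "principal_continuous_TR Y \<delta>"
  shows "sequentially_continuous_map X Y f \<longleftrightarrow>
    (\<exists>f'. continuous_map baire_space baire_space f' \<and> f \<circ> \<gamma> = \<delta> \<circ> f')"
proof -
  have cont: "continuous_map baire_space X \<gamma>" "continuous_map baire_space Y \<delta>"
    and surj: "range \<gamma> = topspace X"
    using \<gamma> \<delta> by (auto simp: principal_continuous_TR_def)
  show ?thesis
  proof
    assume "sequentially_continuous_map X Y f"
    \<comment> \<open>Composing with \<open>\<gamma>\<close> moves the domain to Baire space, where
      sequential continuity amounts to continuity, so principality of \<open>\<delta>\<close>
      applies.\<close>
    with cont(1) have "continuous_map baire_space Y (f \<circ> \<gamma>)"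
      using continuous_map_imp_sequentially_continuous_map
        sequentially_continuous_map_compose sequentially_continuous_map_imp_continuous_map
      by blast
    then show "\<exists>f'. continuous_map baire_space baire_space f' \<and> f \<circ> \<gamma> = \<delta> \<circ> f'"
      using \<delta> unfolding principal_continuous_TR_def by blast
  next
    assume "\<exists>f'. continuous_map baire_space baire_space f' \<and> f \<circ> \<gamma> = \<delta> \<circ> f'"
    then have f\<gamma>: "continuous_map baire_space Y (f \<circ> \<gamma>)"
      using cont(2) continuous_map_compose by metis
    show "sequentially_continuous_map X Y f"
      unfolding sequentially_continuous_map_def
    proof (intro conjI allI impI)
      \<comment> \<open>Each point of \<open>X\<close> is a value of \<open>\<gamma>\<close>, and
        \<open>f \<circ> \<gamma>\<close> takes values in \<open>Y\<close>.\<close>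
      show "f \<in> topspace X \<rightarrow> topspace Y"
        using f\<gamma> by (auto simp: continuous_map_def surj[symmetric])
      fix s x assume "range s \<subseteq> topspace X \<and> limitin X s x sequentially"
      then obtain p l where "p \<longlonglongrightarrow> l" and p: "\<gamma> \<circ> p = s" "\<gamma> l = x"
        using principal_continuous_TR_limitin_lift[OF \<gamma>] by blast
      then have "limitin Y (f \<circ> \<gamma> \<circ> p) ((f \<circ> \<gamma>) l) sequentially"
        using continuous_map_limit[OF f\<gamma>, of p l] by simp
      with p show "limitin Y (f \<circ> s) (f x) sequentially"
        by (simp add: comp_assoc)
    qed
  qed
qed

text \<open>A continuous reduction \<open>h\<close> is sequentially continuous, so it lifts along
  \<open>\<gamma>\<close> on both sides. The lift \<open>h'\<close> is the required reduction, since
  \<open>h (\<gamma> z) = \<gamma> (h' z)\<close>.\<close>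

lemma wadge_reducible_vimage_TR:
  assumes \<gamma>: "principal_continuous_TR X \<gamma>" and "wadge_reducible X A B"
  shows "wadge_reducible baire_space (\<gamma> -` A) (\<gamma> -` B)"
proof -
  obtain h where h: "continuous_map X X h" "A = {z \<in> topspace X. h z \<in> B}"
    using assms(2) by (auto simp: wadge_reducible_def)
  obtain h' where h': "continuous_map baire_space baire_space h'" "h \<circ> \<gamma> = \<gamma> \<circ> h'"
    using continuous_map_imp_sequentially_continuous_map[OF h(1)]
      sequentially_continuous_map_iff_lift[OF \<gamma> \<gamma>] by blast
  \<comment> \<open>This discharges the carrier condition in the description of \<open>A\<close> by
    \<open>h\<close>.\<close>
  have "\<gamma> z \<in> topspace X" for z
    using \<gamma> by (auto simp: principal_continuous_TR_def)
  with h(2) h'(2) have "\<gamma> -` A = {z \<in> topspace baire_space. h' z \<in> \<gamma> -` B}"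
    by (auto simp: fun_eq_iff)
  with h'(1) show ?thesis unfolding wadge_reducible_def by blast
qed

theorem theorem7p4:
  fixes X :: "'a topology" and Y :: "'b topology"
    and \<gamma> :: "(nat \<Rightarrow> nat) \<Rightarrow> 'a" and \<delta> :: "(nat \<Rightarrow> nat) \<Rightarrow> 'b"
  assumes "principal_continuous_TR X \<gamma>"
    and "principal_continuous_TR Y \<delta>"
  shows "(\<forall>f \<in> topspace X \<rightarrow> topspace Y.
            sequentially_continuous_map X Y f \<longleftrightarrow>
            (\<exists>f'. continuous_map baire_space baire_space f' \<and> f \<circ> \<gamma> = \<delta> \<circ> f')) \<and>
         (\<forall>A B. A \<subseteq> topspace X \<longrightarrow> B \<subseteq> topspace X \<longrightarrow> wadge_reducible X A B \<longrightarrow>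
            wadge_reducible baire_space (\<gamma> -` A) (\<gamma> -` B))"
  using sequentially_continuous_map_iff_lift[OF assms] wadge_reducible_vimage_TR[OF assms(1)]
  by blast

end
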